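(* Let $l \ge 1$ be an integer, let $D \subset \mathbb{C}$ be an $l$-connected domain bounded by Jordan curves, and let $p \in \partial D$ be a boundary point. Then there exists a neighbourhood $U$ of $p$ such that $U \cap D$ is simply connected and $$\lim_{z \to p} \frac{s_{U \cap D}(z)}{s_D(z)} = 1,$$ where the limit is taken over $z \in U \cap D$.
   Context: An $l$-connected domain bounded by Jordan curves is a domain (connected open set) in $\mathbb{C}$ whose boundary is the union of $l$ pairwise disjoint Jordan curves (simple closed curves). Span metric: for a domain $D \subset \mathbb{C}$ and $\zeta \in D$, $$s_D(\zeta) := \sup\left\{ |f'(\zeta)|^2 : f \text{ holomorphic on } D,\ \int_D |f'(z)|^2\, dA(z) \le \pi \right\},$$ where $dA$ is planar Lebesgue measure. The span metric is $s_D(z)|dz|^2$. *)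

theory Defs
  imports "HOL-Complex_Analysis.Complex_Analysis"
begin

definition jordan_curve :: "complex set \<Rightarrow> bool" where
  "jordan_curve C \<longleftrightarrow>
     (\<exists>g. simple_path g \<and> pathfinish g = pathstart g \<and> path_image g = C)"

text \<open>No boundedness of the domain is required: the exterior of a Jordan curve,
  for instance, qualifies with one boundary curve.\<close>

definition jordan_domain :: "nat \<Rightarrow> complex set \<Rightarrow> bool" where
  "jordan_domain l D \<longleftrightarrow> open D \<and> connected D \<and>
     (\<exists>C :: nat \<Rightarrow> complex set. (\<forall>i<l. jordan_curve (C i)) \<and>
        disjoint_family_on C {..<l} \<and> frontier D = (\<Union>i<l. C i))"

text \<open>The Dirichlet integral is taken in the extended nonnegative reals, so that functions with
  infinite Dirichlet integral are excluded. For open \<open>D\<close> containing \<open>\<zeta>\<close>, the set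
  below contains \<open>0\<close> and is bounded above: by the area mean value property,
  \<open>(cmod (deriv f \<zeta>))\<^sup>2 \<le> 1 / r\<^sup>2\<close> whenever \<open>ball \<zeta> r \<subseteq> D\<close>. Hence the real supremum is
  the true one.\<close>

definition span_metric :: "complex set \<Rightarrow> complex \<Rightarrow> real" where
  "span_metric D \<zeta> = Sup {(cmod (deriv f \<zeta>))\<^sup>2 | f. f holomorphic_on D \<and>
     (\<integral>\<^sup>+ z\<in>D. ennreal ((cmod (deriv f z))\<^sup>2) \<partial>lborel) \<le> ennreal pi}"

end

theory Submission
  imports Defs
begin

text \<open>Let \<open>S\<close> be the side, containing \<open>D\<close>, of the boundary curve through \<open>p\<close>, and \<open>V\<close> the component of
  \<open>S \<inter> ball p \<epsilon>\<close> near \<open>p\<close>; by Janiszewski's theorem \<open>V\<close> contains all of \<open>S\<close> close to \<open>p\<close>, so \<open>V = U \<inter> D\<close> for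
  the neighbourhood \<open>U = V \<union> ball p \<delta>\<close> of \<open>p\<close>, and \<open>V\<close> is simply connected because no winding number of a
  loop in it is nonzero. A translation, or an inversion if \<open>S\<close> is the outside of the curve, embeds \<open>S\<close> in a
  bounded simply connected \<open>\<Omega>\<close> that omits the image \<open>0\<close> of \<open>p\<close>. Let \<open>g\<close> be the Riemann map of the disc onto \<open>\<Omega>\<close>
  sending \<open>0\<close> to the image of \<open>z\<close>. As \<open>g\<close> is bounded and has no zero, the Schwarz lemma applied to
  \<open>log g\<close> shows that \<open>g\<close> is uniformly small on \<open>ball 0 r\<close> once \<open>g 0\<close> is small, so \<open>ball 0 r\<close>
  is mapped into the image of \<open>V\<close>. The conformal invariance of the Dirichlet integral and the area mean value
  property then give \<open>span_metric V z \<le> span_metric D z / r\<^sup>2\<close>, while monotonicity gives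
  \<open>span_metric D z \<le> span_metric V z\<close>.\<close>

section \<open>Change of variables for nonnegative integrals in the plane\<close>

text \<open>If the right-hand side is infinite there is nothing to prove; otherwise \<open>f\<close>
  is absolutely integrable on the image and the Lebesgue change of variables theorem applies, with
  real values encoded in \<open>real^1\<close>. Claiming only \<le> is what disposes of the infinite
  case.\<close>

lemma nn_integral_change_of_variables_le:
  fixes f :: "real^'m::{finite,wellorder} \<Rightarrow> real" and g :: "real^'m::_ \<Rightarrow> real^'m::_"
  assumes S: "S \<in> sets borel" and gS: "g ` S \<in> sets borel"
    and der: "\<And>x. x \<in> S \<Longrightarrow> (g has_derivative g' x) (at x within S)"
    and inj: "inj_on g S"
    and f: "set_borel_measurable borel (g ` S) f" and nonneg: "\<And>y. y \<in> g ` S \<Longrightarrow> 0 \<le> f y"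
  shows "(\<integral>\<^sup>+x\<in>S. ennreal (\<bar>det (matrix (g' x))\<bar> * f (g x)) \<partial>lborel) \<le> (\<integral>\<^sup>+y\<in>g ` S. ennreal (f y) \<partial>lborel)"
proof (cases "(\<integral>\<^sup>+y\<in>g ` S. ennreal (f y) \<partial>lborel) = \<infinity>")
  case False
  let ?F = "\<lambda>y. indicator (g ` S) y * f y"
  have meas: "?F \<in> borel_measurable borel"
    using f by (simp add: set_borel_measurable_def)
  have F: "(\<integral>\<^sup>+y\<in>g ` S. ennreal (f y) \<partial>lborel) = (\<integral>\<^sup>+y. ennreal (?F y) \<partial>lborel)"
    by (intro nn_integral_cong) (auto simp: indicator_def)
  then obtain r where r: "(\<integral>\<^sup>+y. ennreal (?F y) \<partial>lborel) = ennreal r" "0 \<le> r"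
    using False by (cases "\<integral>\<^sup>+y. ennreal (?F y) \<partial>lborel" rule: ennreal_cases) auto
  have "(?F has_integral r) UNIV"
    by (rule nn_integral_has_integral) (use meas r nonneg in \<open>auto simp: indicator_def\<close>)
  then have I: "(f has_integral r) (g ` S)"
    by (subst has_integral_restrict_UNIV [symmetric])
       (simp add: indicator_def of_bool_def if_distrib[of "\<lambda>x. x * f _"] cong: if_cong)
  then have "f absolutely_integrable_on (g ` S)"
    using nonneg by (intro nonnegative_absolutely_integrable_1) auto
  with I have "(\<lambda>x. vec (f x) :: real^1) absolutely_integrable_on (g ` S) \<and>
      integral (g ` S) (\<lambda>x. vec (f x) :: real^1) = vec r"
    by (auto simp: absolutely_integrable_on_1_iff integral_on_1_eq integral_unique)
  then have "(\<lambda>x. \<bar>det (matrix (g' x))\<bar> *\<^sub>R (vec (f (g x)) :: real^1)) absolutely_integrable_on S \<and>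
      integral S (\<lambda>x. \<bar>det (matrix (g' x))\<bar> *\<^sub>R (vec (f (g x)) :: real^1)) = vec r"
    using has_absolute_integral_change_of_variables [OF _ der inj, of "\<lambda>x. vec (f x) :: real^1" "vec r"] S
    by auto
  then have "(\<lambda>x. \<bar>det (matrix (g' x))\<bar> * f (g x)) absolutely_integrable_on S \<and>
      integral S (\<lambda>x. \<bar>det (matrix (g' x))\<bar> * f (g x)) = r"
    by (auto simp: absolutely_integrable_on_1_iff integral_on_1_eq)
  then have "((\<lambda>x. \<bar>det (matrix (g' x))\<bar> * f (g x)) has_integral r) S"
    using absolutely_integrable_on_def has_integral_iff by blast
  then have "(\<integral>\<^sup>+x\<in>S. ennreal (\<bar>det (matrix (g' x))\<bar> * f (g x)) \<partial>lborel) = ennreal r"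
    by (rule nn_integral_has_integral_lebesgue' [rotated]) (use nonneg in auto)
  then show ?thesis
    using r F by simp
qed simp

text \<open>The Jacobian is a determinant over \<open>real^2\<close>; this map and
  \<open>vec_of_complex\<close> carry integrals between \<open>real^2\<close> and the complex
  plane.\<close>

definition complex_of_vec :: "real^2 \<Rightarrow> complex" where
  "complex_of_vec v = Complex (v $ 1) (v $ 2)"

definition vec_of_complex :: "complex \<Rightarrow> real^2" where
  "vec_of_complex z = vector [Re z, Im z]"

lemma complex_of_vec_of_complex [simp]: "complex_of_vec (vec_of_complex z) = z"
  by (simp add: complex_of_vec_def vec_of_complex_def complex_eq_iff)

lemma vec_of_complex_of_vec [simp]: "vec_of_complex (complex_of_vec v) = v"
  by (simp add: complex_of_vec_def vec_of_complex_def vec_eq_iff forall_2)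

lemma bounded_linear_complex_of_vec: "bounded_linear complex_of_vec"
  by (rule linear_conv_bounded_linear [THEN iffD1], rule linearI)
     (auto simp: complex_of_vec_def complex_eq_iff)

lemma bounded_linear_vec_of_complex: "bounded_linear vec_of_complex"
  by (rule linear_conv_bounded_linear [THEN iffD1], rule linearI)
     (auto simp: vec_of_complex_def vec_eq_iff forall_2)

lemma borel_measurable_complex_of_vec [measurable]: "complex_of_vec \<in> borel \<rightarrow>\<^sub>M borel"
  by (intro borel_measurable_continuous_onI linear_continuous_on bounded_linear_complex_of_vec)

lemma vec_of_complex_image: "vec_of_complex ` S = complex_of_vec -` S"
  by (auto simp: image_iff) (metis vec_of_complex_of_vec)

text \<open>Lebesgue measure is determined by the volumes of boxes, and the preimage of a box is a
  box with the same side lengths.\<close>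

lemma lborel_complex_of_vec: "distr lborel borel complex_of_vec = lborel"
proof (rule lborel_eqI [symmetric])
  fix l u :: complex
  assume le: "\<And>b. b \<in> Basis \<Longrightarrow> l \<bullet> b \<le> u \<bullet> b"
  have eq: "complex_of_vec -` box l u = box (vec_of_complex l) (vec_of_complex u)"
    by (auto simp: box_def complex_of_vec_def vec_of_complex_def Basis_complex_def Basis_vec_def
        inner_axis forall_2)
  have le': "Re l \<le> Re u" "Im l \<le> Im u"
    using le[of 1] le[of \<i>] by (auto simp: Basis_complex_def)
  have "emeasure (distr lborel borel complex_of_vec) (box l u)
      = emeasure lborel (box (vec_of_complex l) (vec_of_complex u))"
    by (subst emeasure_distr) (auto simp: eq)
  also have "\<dots> = ennreal ((Re u - Re l) * (Im u - Im l))"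
    using le' by (subst emeasure_lborel_box)
      (auto simp: Basis_vec_def vec_of_complex_def inner_axis UNIV_2 axis_eq_axis)
  also have "\<dots> = (\<Prod>b\<in>Basis. (u - l) \<bullet> b)"
    by (simp add: Basis_complex_def)
  finally show "emeasure (distr lborel borel complex_of_vec) (box l u) = (\<Prod>b\<in>Basis. (u - l) \<bullet> b)" .
qed simp

lemma nn_integral_complex_of_vec:
  assumes "f \<in> borel_measurable borel"
  shows "(\<integral>\<^sup>+z. f z \<partial>lborel) = (\<integral>\<^sup>+v. f (complex_of_vec v) \<partial>lborel)"
  by (subst lborel_complex_of_vec [symmetric], subst nn_integral_distr) (use assms in auto)

text \<open>For \<open>c = a + ib\<close> the matrix has rows (a, -b) and (b, a). Hence the Jacobian
  of a holomorphic map is the squared modulus of its derivative.\<close>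

lemma det_complex_mult:
  "det (matrix (\<lambda>v. vec_of_complex (c * complex_of_vec v))) = (cmod c)\<^sup>2"
  by (simp add: det_2 matrix_def vec_of_complex_def complex_of_vec_def axis_def cmod_def power2_eq_square)

text \<open>Used in two ways: with \<open>f\<close> constantly 1 it bounds the Dirichlet integral of
  \<open>g\<close> by the area of its image; with \<open>f\<close> the squared modulus of a
  derivative it bounds the Dirichlet integral of a composite.\<close>

lemma nn_integral_holomorphic_substitution_le:
  assumes "open S" and hol: "g holomorphic_on S" and inj: "inj_on g S"
    and cont: "continuous_on (g ` S) f" and nonneg: "\<And>w. w \<in> g ` S \<Longrightarrow> 0 \<le> f w"
  shows "(\<integral>\<^sup>+z\<in>S. ennreal ((cmod (deriv g z))\<^sup>2 * f (g z)) \<partial>lborel) \<le> (\<integral>\<^sup>+w\<in>g ` S. ennreal (f w) \<partial>lborel)"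
proof -
  let ?h = "\<lambda>v. vec_of_complex (g (complex_of_vec v))"
  let ?h' = "\<lambda>v w. vec_of_complex (deriv g (complex_of_vec v) * complex_of_vec w)"
  let ?S = "complex_of_vec -` S"
  have "open (g ` S)"
    using assms open_mapping_thm3 by blast
  have img: "?h ` ?S = complex_of_vec -` (g ` S)"
    by (force simp flip: vec_of_complex_image)
  have borel: "?S \<in> sets borel" "complex_of_vec -` (g ` S) \<in> sets borel"
    using \<open>open S\<close> \<open>open (g ` S)\<close> continuous_open_vimage[OF _ linear_continuous_at[OF bounded_linear_complex_of_vec]]
    by auto
  have der: "(?h has_derivative ?h' v) (at v within ?S)" if "v \<in> ?S" for v
  proof -
    have "(g has_derivative (\<lambda>w. deriv g (complex_of_vec v) * w)) (at (complex_of_vec v))"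
      using that hol \<open>open S\<close> has_field_derivative_def holomorphic_derivI vimageE by blast
    then have "(g \<circ> complex_of_vec has_derivative (\<lambda>w. deriv g (complex_of_vec v) * w) \<circ> complex_of_vec) (at v)"
      by (rule diff_chain_at [OF bounded_linear.has_derivative [OF bounded_linear_complex_of_vec has_derivative_ident]])
    then have "(?h has_derivative ?h' v) (at v)"
      using bounded_linear.has_derivative [OF bounded_linear_vec_of_complex] by (fastforce simp: o_def)
    then show ?thesis
      by (rule has_derivative_at_withinI)
  qed
  have inj': "inj_on ?h ?S"
    using inj by (auto simp: inj_on_def) (metis complex_of_vec_of_complex vec_of_complex_of_vec)
  have meas: "(\<lambda>w. indicator (g ` S) w * f w) \<in> borel_measurable borel"
    using borel_measurable_continuous_on_indicator [OF _ cont] \<open>open (g ` S)\<close> by simp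
  have "(\<lambda>v. indicator (g ` S) (complex_of_vec v) * f (complex_of_vec v)) \<in> borel_measurable borel"
    using measurable_compose [OF borel_measurable_complex_of_vec meas] .
  then have meas': "set_borel_measurable borel (?h ` ?S) (f \<circ> complex_of_vec)"
    unfolding img set_borel_measurable_def by (simp add: indicator_vimage)
  have "continuous_on S (\<lambda>z. (cmod (deriv g z))\<^sup>2 * f (g z))"
    by (intro continuous_intros holomorphic_on_imp_continuous_on holomorphic_deriv hol \<open>open S\<close>
        continuous_on_compose2 [OF cont]) auto
  then have meas2: "(\<lambda>z. indicator S z * ((cmod (deriv g z))\<^sup>2 * f (g z))) \<in> borel_measurable borel"
    using borel_measurable_continuous_on_indicator \<open>open S\<close> by (metis (no_types, lifting) borel_open real_scaleR_def measurable_cong)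
  have "(\<integral>\<^sup>+z\<in>S. ennreal ((cmod (deriv g z))\<^sup>2 * f (g z)) \<partial>lborel)
      = (\<integral>\<^sup>+z. ennreal (indicator S z * ((cmod (deriv g z))\<^sup>2 * f (g z))) \<partial>lborel)"
    by (intro nn_integral_cong) (auto simp: indicator_def)
  also have "\<dots> = (\<integral>\<^sup>+v. ennreal (indicator S (complex_of_vec v) *
      ((cmod (deriv g (complex_of_vec v)))\<^sup>2 * f (g (complex_of_vec v)))) \<partial>lborel)"
    by (rule nn_integral_complex_of_vec) (use meas2 in measurable)
  also have "\<dots> = (\<integral>\<^sup>+v\<in>?S. ennreal (\<bar>det (matrix (?h' v))\<bar> * (f \<circ> complex_of_vec) (?h v)) \<partial>lborel)"
    by (intro nn_integral_cong) (auto simp: indicator_def det_complex_mult)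
  also have "\<dots> \<le> (\<integral>\<^sup>+v\<in>?h ` ?S. ennreal ((f \<circ> complex_of_vec) v) \<partial>lborel)"
    by (rule nn_integral_change_of_variables_le)
       (use borel der inj' meas' nonneg in \<open>auto simp: img o_def\<close>)
  also have "\<dots> = (\<integral>\<^sup>+v. ennreal (indicator (g ` S) (complex_of_vec v) * f (complex_of_vec v)) \<partial>lborel)"
    unfolding img by (intro nn_integral_cong) (auto simp: indicator_def)
  also have "\<dots> = (\<integral>\<^sup>+w. ennreal (indicator (g ` S) w * f w) \<partial>lborel)"
    by (rule nn_integral_complex_of_vec [symmetric]) (use meas in measurable)
  also have "\<dots> = (\<integral>\<^sup>+w\<in>g ` S. ennreal (f w) \<partial>lborel)"
    by (intro nn_integral_cong) (auto simp: indicator_def)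
  finally show ?thesis .
qed

lemma emeasure_ball_complex: "0 \<le> r \<Longrightarrow> emeasure lborel (ball (c::complex) r) = ennreal (pi * r\<^sup>2)"
  by (simp add: emeasure_ball unit_ball_vol_2)

section \<open>Mean value inequalities for squared moduli\<close>

text \<open>Cauchy's formula on the unit circle, applied to the square of \<open>h\<close>: squaring
  before integrating gives the squared modulus from the triangle inequality alone. As
  \<open>z\<close> lies in the open ball, \<open>F\<close> is holomorphic on the closed unit
  disc.\<close>

lemma circle_mean_value_le:
  assumes hol: "h holomorphic_on ball \<zeta> r" and z: "z \<in> ball \<zeta> r"
  shows "ennreal ((cmod (h \<zeta>))\<^sup>2)
    \<le> (\<integral>\<^sup>+t\<in>{0..1}. ennreal ((cmod (h (\<zeta> + exp (2 * pi * \<i> * of_real t) * (z - \<zeta>))))\<^sup>2) \<partial>lborel)"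
proof -
  define F where "F u = (h (\<zeta> + u * (z - \<zeta>)))\<^sup>2" for u
  have sub: "\<zeta> + u * (z - \<zeta>) \<in> ball \<zeta> r" if "u \<in> cball 0 1" for u
  proof -
    have "cmod (u * (z - \<zeta>)) \<le> 1 * cmod (z - \<zeta>)"
      unfolding norm_mult using that by (intro mult_right_mono) auto
    then show ?thesis
      using z by (simp add: dist_norm norm_minus_commute)
  qed
  have "F holomorphic_on cball 0 1"
    unfolding F_def using sub
    by (intro holomorphic_intros holomorphic_on_compose_gen [OF _ hol, unfolded o_def]) auto
  then have "((\<lambda>u. F u / (u - 0)) has_contour_integral (2 * of_real pi * \<i> * F 0)) (circlepath 0 1)"
    by (intro Cauchy_integral_circlepath_simple) auto
  \<comment> \<open>The kernel \<open>1 / u\<close> cancels against the velocity of the circle,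
    which is a constant times \<open>u\<close>, so a plain mean of \<open>F\<close> remains.\<close>
  then have "((\<lambda>t. 2 * pi * \<i> * F (exp (2 * pi * \<i> * of_real t))) has_integral (2 * of_real pi * \<i> * F 0)) {0..1}"
    unfolding has_contour_integral
  proof (rule has_integral_eq [rotated])
    fix t :: real
    define e where "e = exp (2 * pi * \<i> * of_real t)"
    have "circlepath 0 1 t = e"
      by (simp add: circlepath e_def)
    moreover have "vector_derivative (circlepath 0 1) (at t) = 2 * pi * \<i> * e"
      by (simp add: vector_derivative_circlepath e_def)
    moreover have "e \<noteq> 0"
      by (simp add: e_def)
    ultimately show "F (circlepath 0 1 t) / (circlepath 0 1 t - 0) * vector_derivative (circlepath 0 1) (at t)
        = 2 * pi * \<i> * F (exp (2 * pi * \<i> * of_real t))"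
      unfolding e_def [symmetric] by (simp add: field_simps)
  qed
  from has_integral_mult_right [OF this, of "1 / (2 * pi * \<i>)"]
  have int: "((\<lambda>t. F (exp (2 * pi * \<i> * of_real t))) has_integral F 0) {0..1}"
    by simp
  have "continuous_on (cball 0 1) F"
    by (simp add: \<open>F holomorphic_on cball 0 1\<close> holomorphic_on_imp_continuous_on)
  moreover have "continuous_on {0..1} (\<lambda>t. exp (2 * pi * \<i> * of_real t))"
    by (intro continuous_intros)
  moreover have "(\<lambda>t. exp (2 * pi * \<i> * of_real t)) ` {0..1} \<subseteq> cball 0 1"
    by auto
  ultimately have cont: "continuous_on {0..1} (\<lambda>t. cmod (F (exp (2 * pi * \<i> * of_real t))))"
    by (rule continuous_on_norm [OF continuous_on_compose2])
  have F_int: "(\<lambda>t. cmod (F (exp (2 * pi * \<i> * of_real t)))) integrable_on {0..1}"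
    by (rule integrable_continuous_interval [OF cont])
  have "cmod (integral {0..1} (\<lambda>t. F (exp (2 * pi * \<i> * of_real t))))
      \<le> integral {0..1} (\<lambda>t. cmod (F (exp (2 * pi * \<i> * of_real t))))"
    by (rule integral_norm_bound_integral [OF has_integral_integrable [OF int] F_int order_refl])
  then have "cmod (F 0) \<le> integral {0..1} (\<lambda>t. cmod (F (exp (2 * pi * \<i> * of_real t))))"
    unfolding integral_unique [OF int] .
  moreover have "(\<integral>\<^sup>+t\<in>{0..1}. ennreal (cmod (F (exp (2 * pi * \<i> * of_real t)))) \<partial>lborel)
      = ennreal (integral {0..1} (\<lambda>t. cmod (F (exp (2 * pi * \<i> * of_real t)))))"
    by (rule nn_integral_has_integral_lebesgue' [OF norm_ge_zero integrable_integral [OF F_int]])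
  ultimately show ?thesis
    by (simp add: F_def norm_power ennreal_leI)
qed

text \<open>Rotating the disc about its centre and averaging over the angle reduces the inequality for
  the area integral to the one for circles, without polar coordinates.\<close>

lemma area_mean_value_le:
  assumes hol: "h holomorphic_on ball \<zeta> r" and "0 < r"
  shows "ennreal (pi * r\<^sup>2 * (cmod (h \<zeta>))\<^sup>2) \<le> (\<integral>\<^sup>+z\<in>ball \<zeta> r. ennreal ((cmod (h z))\<^sup>2) \<partial>lborel)"
    (is "_ \<le> ?I")
proof -
  let ?B = "ball \<zeta> r"
  define R where "R t z = \<zeta> + exp (2 * pi * \<i> * of_real t) * (z - \<zeta>)" for t :: real and z
  have norm_R: "R t z \<in> ?B \<longleftrightarrow> z \<in> ?B" for t z
    by (simp add: R_def dist_norm norm_mult norm_minus_commute)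
  \<comment> \<open>The rotation maps the disc onto itself and its derivative has modulus 1, so the
    substitution inequality has no extra factor.\<close>
  have rot: "(\<integral>\<^sup>+z\<in>?B. ennreal ((cmod (h (R t z)))\<^sup>2) \<partial>lborel) \<le> ?I" for t
  proof -
    have der: "(R t has_field_derivative exp (2 * pi * \<i> * of_real t)) (at z)" for z
      unfolding R_def by (auto intro!: derivative_eq_intros)
    have "w \<in> R t ` ?B" if "w \<in> ?B" for w
    proof (rule image_eqI)
      show "w = R t (\<zeta> + exp (- (2 * pi * \<i> * of_real t)) * (w - \<zeta>))"
        by (simp add: R_def exp_minus field_simps)
      with that show "\<zeta> + exp (- (2 * pi * \<i> * of_real t)) * (w - \<zeta>) \<in> ?B"
        using norm_R by metis
    qed
    then have img: "R t ` ?B = ?B"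
      using norm_R by auto
    have "(\<integral>\<^sup>+z\<in>?B. ennreal ((cmod (deriv (R t) z))\<^sup>2 * (cmod (h (R t z)))\<^sup>2) \<partial>lborel)
        \<le> (\<integral>\<^sup>+z\<in>R t ` ?B. ennreal ((cmod (h z))\<^sup>2) \<partial>lborel)"
    proof (rule nn_integral_holomorphic_substitution_le)
      show "R t holomorphic_on ?B"
        unfolding R_def by (intro holomorphic_intros)
      show "inj_on (R t) ?B"
        by (auto simp: inj_on_def R_def)
      show "continuous_on (R t ` ?B) (\<lambda>z. (cmod (h z))\<^sup>2)"
        unfolding img by (intro continuous_intros holomorphic_on_imp_continuous_on hol)
    qed auto
    then show ?thesis
      by (simp add: img DERIV_imp_deriv [OF der])
  qed
  let ?G = "\<lambda>t z. indicator {0..1} t * (indicator ?B z * ennreal ((cmod (h (R t z)))\<^sup>2))"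
  have cont_R: "continuous_on (UNIV \<times> ?B) (\<lambda>x. R (fst x) (snd x))"
    unfolding R_def by (intro continuous_intros)
  \<comment> \<open>Continuity in both variables on the open set \<open>UNIV \<times> ?B\<close>
    gives the joint measurability that Fubini needs.\<close>
  have "continuous_on (UNIV \<times> ?B) (\<lambda>x. (cmod (h (R (fst x) (snd x))))\<^sup>2)"
    by (intro continuous_on_power continuous_on_norm
        continuous_on_compose2 [OF holomorphic_on_imp_continuous_on [OF hol] cont_R])
       (auto simp del: mem_ball simp: norm_R)
  moreover have "UNIV \<times> ?B \<in> sets (borel :: (real \<times> complex) measure)"
    by (intro borel_open open_Times) auto
  ultimately have "(\<lambda>x. indicator (UNIV \<times> ?B) x * (cmod (h (R (fst x) (snd x))))\<^sup>2) \<in> borel_measurable borel"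
    using borel_measurable_continuous_on_indicator by fastforce
  then have "(\<lambda>x. indicator (UNIV \<times> ?B) x * (cmod (h (R (fst x) (snd x))))\<^sup>2)
      \<in> borel_measurable ((lborel :: real measure) \<Otimes>\<^sub>M (lborel :: complex measure))"
    by (simp add: lborel_prod)
  then have "(\<lambda>x. indicator {0..1} (fst x) * ennreal (indicator (UNIV \<times> ?B) x * (cmod (h (R (fst x) (snd x))))\<^sup>2))
      \<in> borel_measurable ((lborel :: real measure) \<Otimes>\<^sub>M (lborel :: complex measure))"
    by measurable
  also have "(\<lambda>x. indicator {0..1} (fst x) * ennreal (indicator (UNIV \<times> ?B) x * (cmod (h (R (fst x) (snd x))))\<^sup>2))
      = (\<lambda>(t, z). ?G t z)"
    by (auto simp: indicator_def fun_eq_iff)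
  finally have meas: "(\<lambda>(t, z). ?G t z) \<in> borel_measurable ((lborel :: real measure) \<Otimes>\<^sub>M (lborel :: complex measure))" .
  have "ennreal (pi * r\<^sup>2 * (cmod (h \<zeta>))\<^sup>2) = (\<integral>\<^sup>+z\<in>?B. ennreal ((cmod (h \<zeta>))\<^sup>2) \<partial>lborel)"
    using \<open>0 < r\<close>
    by (subst nn_integral_cmult_indicator) (simp_all add: emeasure_ball_complex mult.commute flip: ennreal_mult)
  \<comment> \<open>The circle inequality holds through each \<open>z\<close> of the disc; after
    exchanging the integrals, \<open>rot\<close> bounds the inner one for each fixed angle.\<close>
  also have "\<dots> \<le> (\<integral>\<^sup>+z. \<integral>\<^sup>+t. ?G t z \<partial>lborel \<partial>lborel)"
  proof (rule nn_integral_mono)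
    fix z
    show "ennreal ((cmod (h \<zeta>))\<^sup>2) * indicator ?B z \<le> (\<integral>\<^sup>+t. ?G t z \<partial>lborel)"
      using circle_mean_value_le [OF hol, of z]
      by (cases "z \<in> ?B") (simp_all add: R_def mult.commute)
  qed
  also have "\<dots> = (\<integral>\<^sup>+t. \<integral>\<^sup>+z. ?G t z \<partial>lborel \<partial>lborel)"
    by (rule lborel_pair.Fubini' [OF meas])
  also have "\<dots> \<le> (\<integral>\<^sup>+t. indicator {0..1} t * ?I \<partial>(lborel :: real measure))"
  proof (rule nn_integral_mono)
    fix t :: real
    show "(\<integral>\<^sup>+z. ?G t z \<partial>lborel) \<le> indicator {0..1} t * ?I"
      using rot [of t] by (cases "t \<in> {0..1}") (auto simp: mult.commute)
  qed
  also have "\<dots> = ?I"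
    by (simp add: nn_integral_multc)
  finally show ?thesis .
qed

section \<open>Bounded holomorphic functions without zeros on the disc\<close>

text \<open>\<open>g / M\<close> is \<open>exp u\<close> with \<open>Re u\<close> negative, and the
  Schwarz lemma yields the Harnack inequality
  \<open>Re (u z) \<le> (1 - r) / (1 + r) * Re (u 0)\<close>; exponentiate. The exponent is
  positive, so the bound tends to 0 with \<open>g 0\<close>.\<close>

lemma nonvanishing_bound:
  assumes hol: "g holomorphic_on ball 0 1" and nz: "\<And>z. z \<in> ball 0 1 \<Longrightarrow> g z \<noteq> 0"
    and bound: "\<And>z. z \<in> ball 0 1 \<Longrightarrow> cmod (g z) < M" and "0 < M" and z: "cmod z \<le> r" and r: "r < 1"
  shows "cmod (g z) \<le> M * (cmod (g 0) / M) powr ((1 - r) / (1 + r))"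
proof -
  have zB: "z \<in> ball 0 1" and "0 \<le> r"
    using z r norm_ge_zero [of z] by (simp_all del: norm_ge_zero)
  obtain u where u: "u holomorphic_on ball 0 1" "\<And>z. z \<in> ball 0 1 \<Longrightarrow> g z / of_real M = exp (u z)"
  proof (rule contractible_imp_holomorphic_log [of "\<lambda>z. g z / of_real M" "ball 0 1"])
    show "(\<lambda>z. g z / of_real M) holomorphic_on ball 0 1"
      using \<open>0 < M\<close> by (intro holomorphic_intros hol) auto
  qed (use nz \<open>0 < M\<close> in \<open>auto intro: convex_imp_contractible\<close>)
  have norm_g: "cmod (g z) = M * exp (Re (u z))" if "z \<in> ball 0 1" for z
  proof -
    have "g z = of_real M * exp (u z)"
      using u(2) [OF that] \<open>0 < M\<close> by (simp add: field_simps)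
    then show ?thesis
      using \<open>0 < M\<close> by (simp add: norm_mult)
  qed
  have neg: "Re (u z) < 0" if "z \<in> ball 0 1" for z
    using norm_g [OF that] bound [OF that] \<open>0 < M\<close> by simp
  \<comment> \<open>This is \<open>u\<close> followed by the Moebius map of the left half-plane to
    the unit disc that sends \<open>u 0\<close> to 0.\<close>
  let ?\<phi> = "\<lambda>z. (u z - u 0) / (u z + cnj (u 0))"
  have pos: "u z + cnj (u 0) \<noteq> 0" if "z \<in> ball 0 1" for z
    using neg [OF that] neg [of 0] by (auto simp: complex_eq_iff)
  have "cmod (?\<phi> z) \<le> cmod z"
  proof (rule Schwarz_Lemma)
    show "?\<phi> holomorphic_on ball 0 1"
      using pos by (intro holomorphic_intros u) auto
    fix z :: complex assume "cmod z < 1"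
    then have zB: "z \<in> ball 0 1" by simp
    have "0 < Re (u z) * Re (u 0)"
      using neg [OF zB] neg [of 0] by (simp add: mult_neg_neg)
    then have "(cmod (u z - u 0))\<^sup>2 < (cmod (u z + cnj (u 0)))\<^sup>2"
      unfolding cmod_power2 by (simp add: power2_eq_square algebra_simps)
    then have "cmod (u z - u 0) < cmod (u z + cnj (u 0))"
      by (rule power2_less_imp_less) simp
    then show "cmod (?\<phi> z) < 1"
      using pos [OF zB] by (simp add: norm_divide)
  qed (use zB in auto)
  then have "cmod (u z - u 0) \<le> cmod z * cmod (u z + cnj (u 0))"
    using pos [OF zB] by (simp add: norm_divide field_simps)
  also have "\<dots> \<le> r * cmod (u z + cnj (u 0))"
    using z by (intro mult_right_mono) auto
  finally have "cmod (u z - u 0) \<le> r * cmod (u z + cnj (u 0))" .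
  then have "(cmod (u z - u 0))\<^sup>2 \<le> r\<^sup>2 * (cmod (u z + cnj (u 0)))\<^sup>2"
    by (metis norm_ge_zero power_mono power_mult_distrib)
  then have "(Re (u z) - Re (u 0))\<^sup>2 + (Im (u z) - Im (u 0))\<^sup>2
      \<le> r\<^sup>2 * (Re (u z) + Re (u 0))\<^sup>2 + r\<^sup>2 * (Im (u z) - Im (u 0))\<^sup>2"
    unfolding cmod_power2 by (simp add: algebra_simps)
  moreover have "r\<^sup>2 * (Im (u z) - Im (u 0))\<^sup>2 \<le> 1 * (Im (u z) - Im (u 0))\<^sup>2"
    using \<open>0 \<le> r\<close> r by (intro mult_right_mono power_le_one) auto
  ultimately have "(Re (u z) - Re (u 0))\<^sup>2 \<le> (r * (- Re (u z) - Re (u 0)))\<^sup>2"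
    by (simp add: power_mult_distrib power2_eq_square algebra_simps)
  then have "Re (u z) - Re (u 0) \<le> r * (- Re (u z) - Re (u 0))"
    by (rule power2_le_imp_le) (use \<open>0 \<le> r\<close> neg [OF zB] neg [of 0] in \<open>auto intro: mult_nonneg_nonneg\<close>)
  then have "Re (u z) \<le> (1 - r) / (1 + r) * Re (u 0)"
    using \<open>0 \<le> r\<close> by (simp add: field_simps)
  then have "cmod (g z) \<le> M * exp ((1 - r) / (1 + r) * Re (u 0))"
    using \<open>0 < M\<close> by (simp add: norm_g [OF zB])
  also have "exp ((1 - r) / (1 + r) * Re (u 0)) = (cmod (g 0) / M) powr ((1 - r) / (1 + r))"
    using \<open>0 < M\<close> by (simp add: norm_g exp_powr_real mult.commute)
  finally show ?thesis .
qed

section \<open>The extremal problem and its competitors\<close>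

lemma span_metric_le:
  assumes "\<And>f. f holomorphic_on D \<Longrightarrow> (\<integral>\<^sup>+z\<in>D. ennreal ((cmod (deriv f z))\<^sup>2) \<partial>lborel) \<le> ennreal pi
    \<Longrightarrow> (cmod (deriv f \<zeta>))\<^sup>2 \<le> B"
  shows "span_metric D \<zeta> \<le> B"
  unfolding span_metric_def
proof (rule cSup_least)
  have "(\<lambda>_. 0) holomorphic_on D \<and>
     (\<integral>\<^sup>+ z\<in>D. ennreal ((cmod (deriv (\<lambda>_. 0 :: complex) z))\<^sup>2) \<partial>lborel) \<le> ennreal pi"
    by simp
  then show "{(cmod (deriv f \<zeta>))\<^sup>2 | f. f holomorphic_on D \<and>
     (\<integral>\<^sup>+ z\<in>D. ennreal ((cmod (deriv f z))\<^sup>2) \<partial>lborel) \<le> ennreal pi} \<noteq> {}"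
    by blast
qed (use assms in auto)

text \<open>The area mean value inequality for \<open>deriv f\<close>. It makes the supremum finite
  and later bounds competitors pulled back to \<open>ball 0 r\<close>.\<close>

lemma norm_deriv_le_of_energy:
  assumes hol: "f holomorphic_on ball \<zeta> r" and "0 < r"
    and energy: "(\<integral>\<^sup>+z\<in>ball \<zeta> r. ennreal ((cmod (deriv f z))\<^sup>2) \<partial>lborel) \<le> ennreal pi"
  shows "(cmod (deriv f \<zeta>))\<^sup>2 \<le> 1 / r\<^sup>2"
proof -
  have "ennreal (pi * r\<^sup>2 * (cmod (deriv f \<zeta>))\<^sup>2) \<le> ennreal pi"
    using area_mean_value_le [OF holomorphic_deriv [OF hol open_ball] \<open>0 < r\<close>] energy by (rule order_trans)
  then have "pi * r\<^sup>2 * (cmod (deriv f \<zeta>))\<^sup>2 \<le> pi"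
    by simp
  then show ?thesis
    using \<open>0 < r\<close> by (simp add: field_simps)
qed

lemma set_nn_integral_mono_set:
  "A \<subseteq> B \<Longrightarrow> (\<integral>\<^sup>+x\<in>A. f x \<partial>M) \<le> (\<integral>\<^sup>+x\<in>B. f x \<partial>M)"
  by (intro nn_integral_mono) (auto simp: indicator_def)

text \<open>A real supremum dominates its set only if that set is bounded above; a disc about
  \<open>\<zeta>\<close> inside \<open>D\<close> supplies the bound.\<close>

lemma le_span_metric:
  assumes "open D" "\<zeta> \<in> D" and hol: "f holomorphic_on D"
    and energy: "(\<integral>\<^sup>+z\<in>D. ennreal ((cmod (deriv f z))\<^sup>2) \<partial>lborel) \<le> ennreal pi"
  shows "(cmod (deriv f \<zeta>))\<^sup>2 \<le> span_metric D \<zeta>"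
  unfolding span_metric_def
proof (rule cSup_upper)
  obtain r where r: "0 < r" "ball \<zeta> r \<subseteq> D"
    using assms(1,2) open_contains_ball by blast
  show "bdd_above {(cmod (deriv f \<zeta>))\<^sup>2 | f. f holomorphic_on D \<and>
     (\<integral>\<^sup>+ z\<in>D. ennreal ((cmod (deriv f z))\<^sup>2) \<partial>lborel) \<le> ennreal pi}"
    by (rule bdd_aboveI [of _ "1 / r\<^sup>2"])
       (use r in \<open>auto intro!: norm_deriv_le_of_energy intro: holomorphic_on_subset
          order_trans [OF set_nn_integral_mono_set]\<close>)
qed (use hol energy in blast)

text \<open>Competitors on \<open>D\<close> restrict to competitors on \<open>V\<close>.\<close>

lemma span_metric_antimono:
  assumes "V \<subseteq> D" "open V" "\<zeta> \<in> V"
  shows "span_metric D \<zeta> \<le> span_metric V \<zeta>"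
proof (rule span_metric_le)
  fix f assume f: "f holomorphic_on D" "(\<integral>\<^sup>+z\<in>D. ennreal ((cmod (deriv f z))\<^sup>2) \<partial>lborel) \<le> ennreal pi"
  show "(cmod (deriv f \<zeta>))\<^sup>2 \<le> span_metric V \<zeta>"
    using assms(2,3) holomorphic_on_subset [OF f(1) \<open>V \<subseteq> D\<close>]
      order_trans [OF set_nn_integral_mono_set [OF \<open>V \<subseteq> D\<close>] f(2)]
    by (rule le_span_metric)
qed

text \<open>For an injective map the Dirichlet integral is controlled by the area of the image, here
  at most that of the unit disc. Such maps are therefore competitors.\<close>

lemma energy_le_pi_of_inj_disc:
  assumes "open D" "f holomorphic_on D" "inj_on f D" "f ` D \<subseteq> ball 0 1"
  shows "(\<integral>\<^sup>+z\<in>D. ennreal ((cmod (deriv f z))\<^sup>2) \<partial>lborel) \<le> ennreal pi"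
proof -
  have "(\<integral>\<^sup>+z\<in>D. ennreal ((cmod (deriv f z))\<^sup>2) \<partial>lborel) \<le> (\<integral>\<^sup>+z\<in>f ` D. ennreal 1 \<partial>lborel)"
    using nn_integral_holomorphic_substitution_le [OF assms(1-3), of "\<lambda>_. 1"] by simp
  also have "\<dots> \<le> (\<integral>\<^sup>+z\<in>ball 0 (1::real). ennreal 1 \<partial>(lborel :: complex measure))"
    by (rule set_nn_integral_mono_set [OF assms(4)])
  also have "\<dots> = ennreal pi"
    by (simp add: emeasure_ball_complex)
  finally show ?thesis .
qed

text \<open>\<open>\<theta>\<close> is itself a competitor on \<open>D\<close>, which bounds
  \<open>span_metric D z\<close> below by the squared modulus of \<open>deriv \<theta> z\<close>. A
  competitor \<open>f\<close> on \<open>V\<close>, composed with the inverse \<open>k\<close> of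
  \<open>\<theta>\<close>, has Dirichlet integral at most pi on \<open>ball 0 r\<close>, so its
  derivative at 0 has squared modulus at most \<open>1 / r\<^sup>2\<close>. The two estimates are
  linked by \<open>deriv \<theta> z * deriv k 0 = 1\<close>.\<close>

lemma span_metric_subset_le:
  assumes "open D" "open V" "V \<subseteq> D" "z \<in> V" "0 < r"
    and \<theta>: "\<theta> holomorphic_on D" "inj_on \<theta> D" "\<theta> ` D \<subseteq> ball 0 1" "\<theta> z = 0"
    and sub: "ball 0 r \<subseteq> \<theta> ` V"
  shows "0 < span_metric D z" and "span_metric V z \<le> span_metric D z / r\<^sup>2"
proof -
  have \<theta>V: "\<theta> holomorphic_on V" "inj_on \<theta> V"
    using \<theta> \<open>V \<subseteq> D\<close> by (auto intro: holomorphic_on_subset inj_on_subset)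
  then obtain k where k: "k holomorphic_on \<theta> ` V" "\<And>z. z \<in> V \<Longrightarrow> deriv \<theta> z * deriv k (\<theta> z) = 1"
      "\<And>z. z \<in> V \<Longrightarrow> k (\<theta> z) = z"
    using holomorphic_has_inverse \<open>open V\<close> by metis
  have k0: "k 0 = z" "deriv \<theta> z * deriv k 0 = 1"
    using k(2,3) [OF \<open>z \<in> V\<close>] \<theta>(4) by auto
  have le: "(cmod (deriv \<theta> z))\<^sup>2 \<le> span_metric D z"
    using assms by (intro le_span_metric energy_le_pi_of_inj_disc) auto
  moreover have "0 < (cmod (deriv \<theta> z))\<^sup>2"
    using k0 by auto
  ultimately show "0 < span_metric D z"
    by linarith
  have holk: "k holomorphic_on ball 0 r"
    using holomorphic_on_subset [OF k(1) sub] .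
  have injk: "inj_on k (ball 0 r)"
    by (rule inj_on_subset [OF _ sub]) (auto simp: inj_on_def k(3))
  have kV: "k ` ball 0 r \<subseteq> V"
    using image_mono [OF sub, of k] by (auto simp: k(3) image_image)
  show "span_metric V z \<le> span_metric D z / r\<^sup>2"
  proof (rule span_metric_le)
    fix f assume f: "f holomorphic_on V" "(\<integral>\<^sup>+z\<in>V. ennreal ((cmod (deriv f z))\<^sup>2) \<partial>lborel) \<le> ennreal pi"
    have deriv_fk: "deriv (f \<circ> k) w = deriv f (k w) * deriv k w" if "w \<in> ball 0 r" for w
      using that kV holk f(1) \<open>open V\<close>
      by (intro deriv_chain) (auto simp: holomorphic_on_imp_differentiable_at image_subset_iff)
    have "(\<integral>\<^sup>+w\<in>ball 0 r. ennreal ((cmod (deriv (f \<circ> k) w))\<^sup>2) \<partial>lborel)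
        = (\<integral>\<^sup>+w\<in>ball 0 r. ennreal ((cmod (deriv k w))\<^sup>2 * (cmod (deriv f (k w)))\<^sup>2) \<partial>lborel)"
      by (intro nn_integral_cong) (simp add: indicator_def deriv_fk norm_mult power_mult_distrib mult.commute)
    also have "\<dots> \<le> (\<integral>\<^sup>+z\<in>k ` ball 0 r. ennreal ((cmod (deriv f z))\<^sup>2) \<partial>lborel)"
      using holomorphic_on_subset [OF holomorphic_deriv [OF f(1) \<open>open V\<close>] kV]
      by (intro nn_integral_holomorphic_substitution_le holk injk continuous_on_power continuous_on_norm
          holomorphic_on_imp_continuous_on) auto
    also have "\<dots> \<le> ennreal pi"
      using set_nn_integral_mono_set [OF kV] f(2) by (rule order_trans)
    finally have "(cmod (deriv (f \<circ> k) 0))\<^sup>2 \<le> 1 / r\<^sup>2"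
      using \<open>0 < r\<close> f(1) holk kV
      by (intro norm_deriv_le_of_energy holomorphic_on_compose holomorphic_on_subset [OF f(1) kV])
    then have "(cmod (deriv f z))\<^sup>2 * (cmod (deriv k 0))\<^sup>2 \<le> 1 / r\<^sup>2"
      using \<open>0 < r\<close> by (simp add: deriv_fk k0 norm_mult power_mult_distrib)
    then have "(cmod (deriv \<theta> z))\<^sup>2 * ((cmod (deriv f z))\<^sup>2 * (cmod (deriv k 0))\<^sup>2) \<le> (cmod (deriv \<theta> z))\<^sup>2 * (1 / r\<^sup>2)"
      by (rule mult_left_mono) simp
    moreover have "(cmod (deriv \<theta> z))\<^sup>2 * (cmod (deriv k 0))\<^sup>2 = 1"
      using arg_cong [OF k0(2), of "\<lambda>x. (cmod x)\<^sup>2"] by (simp add: norm_mult power_mult_distrib)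
    then have "(cmod (deriv \<theta> z))\<^sup>2 * ((cmod (deriv f z))\<^sup>2 * (cmod (deriv k 0))\<^sup>2) = (cmod (deriv f z))\<^sup>2"
      by (metis mult.left_commute mult.right_neutral)
    ultimately have "(cmod (deriv f z))\<^sup>2 \<le> (cmod (deriv \<theta> z))\<^sup>2 / r\<^sup>2"
      by simp
    also have "\<dots> \<le> span_metric D z / r\<^sup>2"
      using le by (simp add: divide_right_mono)
    finally show "(cmod (deriv f z))\<^sup>2 \<le> span_metric D z / r\<^sup>2" .
  qed
qed

section \<open>Comparison of the two metrics through the Riemann map\<close>

text \<open>The Riemann map is followed by a disc automorphism \<open>m\<close> that moves the image
  of \<open>a\<close> to 0.\<close>

lemma disc_map_vanishing_at:
  assumes "open \<Omega>" "simply_connected \<Omega>" "\<Omega> \<noteq> UNIV" "a \<in> \<Omega>"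
  obtains f g where "f holomorphic_on \<Omega>" "g holomorphic_on ball 0 1" "f a = 0"
    "\<And>z. z \<in> \<Omega> \<Longrightarrow> f z \<in> ball 0 1 \<and> g (f z) = z" "\<And>w. w \<in> ball 0 1 \<Longrightarrow> g w \<in> \<Omega> \<and> f (g w) = w"
proof -
  obtain f g where fg: "f holomorphic_on \<Omega>" "g holomorphic_on ball 0 1"
    "\<forall>z\<in>\<Omega>. f z \<in> ball 0 1 \<and> g (f z) = z" "\<forall>w\<in>ball 0 1. g w \<in> \<Omega> \<and> f (g w) = w"
    using Riemann_mapping_theorem [of \<Omega>] assms by blast
  then have "f a \<in> ball 0 1"
    using assms by blast
  then obtain m n where mn: "m (f a) = 0" "m holomorphic_on ball 0 1" "m ` ball 0 1 \<subseteq> ball 0 1"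
      "n holomorphic_on ball 0 1" "n ` ball 0 1 \<subseteq> ball 0 1"
      "\<And>z. z \<in> ball 0 1 \<Longrightarrow> m (n z) = z" "\<And>z. z \<in> ball 0 1 \<Longrightarrow> n (m z) = z"
    using ball_biholomorphism_exists by metis
  show thesis
  proof (rule that [of "m \<circ> f" "g \<circ> n"])
    show "m \<circ> f holomorphic_on \<Omega>"
      using fg by (intro holomorphic_on_compose_gen [OF fg(1) mn(2)]) auto
    show "g \<circ> n holomorphic_on ball 0 1"
      by (rule holomorphic_on_compose_gen [OF mn(4) fg(2) mn(5)])
  qed (use fg mn in \<open>auto simp: image_subset_iff\<close>)
qed

text \<open>The threshold depends on \<open>r\<close>, \<open>\<delta>\<close> and the bound of
  \<open>\<Omega>\<close> but not on \<open>z\<close>, although the Riemann map changes with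
  \<open>z\<close>. \<open>\<Omega>\<close> may be larger than the image of \<open>D\<close>; only
  near 0 must it be covered by the image of \<open>V\<close>.\<close>

lemma span_metric_ratio_bound:
  assumes "open D" "open V" "V \<subseteq> D" "open \<Omega>" "simply_connected \<Omega>" "bounded \<Omega>" "0 \<notin> \<Omega>"
    and \<Psi>: "\<Psi> holomorphic_on D" "inj_on \<Psi> D" "\<Psi> ` D \<subseteq> \<Omega>"
    and near: "\<Omega> \<inter> ball 0 \<delta> \<subseteq> \<Psi> ` V" and "0 < \<delta>" and r: "0 < r" "r < 1"
  shows "\<exists>\<epsilon>>0. \<forall>z\<in>V. cmod (\<Psi> z) < \<epsilon> \<longrightarrow> 0 < span_metric D z \<and> span_metric V z \<le> span_metric D z / r\<^sup>2"
proof -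
  obtain M where M: "0 < M" "\<And>w. w \<in> \<Omega> \<Longrightarrow> cmod w < M"
    using \<open>bounded \<Omega>\<close> unfolding bounded_pos_less by blast
  define k where "k = (1 - r) / (1 + r)"
  have "0 < k"
    using r by (simp add: k_def)
  \<comment> \<open>The solution of \<open>M * (\<epsilon> / M) powr k = \<delta>\<close>: below it
    the bound of \<open>nonvanishing_bound\<close> is less than \<open>\<delta>\<close>.\<close>
  define \<epsilon> where "\<epsilon> = M * (\<delta> / M) powr (1 / k)"
  have "0 < \<epsilon>"
    using M \<open>0 < \<delta>\<close> by (simp add: \<epsilon>_def)
  have small: "M * (x / M) powr k < \<delta>" if "0 \<le> x" "x < \<epsilon>" for x
  proof -
    have "x / M < (\<delta> / M) powr (1 / k)"
      using that M by (simp add: \<epsilon>_def field_simps)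
    then have "(x / M) powr k < ((\<delta> / M) powr (1 / k)) powr k"
      using that M \<open>0 < k\<close> by (intro powr_less_mono2) auto
    also have "\<dots> = \<delta> / M"
      using M \<open>0 < \<delta>\<close> \<open>0 < k\<close> by (simp add: powr_powr)
    finally show ?thesis
      using M by (simp add: field_simps)
  qed
  have "0 < span_metric D z \<and> span_metric V z \<le> span_metric D z / r\<^sup>2"
    if z: "z \<in> V" "cmod (\<Psi> z) < \<epsilon>" for z
  proof -
    have "\<Psi> z \<in> \<Omega>" "\<Omega> \<noteq> UNIV"
      using z \<Psi> \<open>V \<subseteq> D\<close> \<open>0 \<notin> \<Omega>\<close> by auto
    from disc_map_vanishing_at [OF \<open>open \<Omega>\<close> \<open>simply_connected \<Omega>\<close> this(2,1)]
    obtain f g where fg: "f holomorphic_on \<Omega>" "g holomorphic_on ball 0 1" "f (\<Psi> z) = 0"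
      "\<And>z. z \<in> \<Omega> \<Longrightarrow> f z \<in> ball 0 1 \<and> g (f z) = z" "\<And>w. w \<in> ball 0 1 \<Longrightarrow> g w \<in> \<Omega> \<and> f (g w) = w"
      by blast
    have g0: "g 0 = \<Psi> z"
      using fg(3,4) \<open>\<Psi> z \<in> \<Omega>\<close> by metis
    have sub: "ball 0 r \<subseteq> (f \<circ> \<Psi>) ` V"
    proof
      fix w :: complex assume w: "w \<in> ball 0 r"
      then have wB: "w \<in> ball 0 1"
        using r by auto
      have "cmod (g w) \<le> M * (cmod (g 0) / M) powr k"
        unfolding k_def
      proof (rule nonvanishing_bound [OF fg(2) _ _ M(1) _ r(2)])
        show "g x \<noteq> 0" "cmod (g x) < M" if "x \<in> ball 0 1" for x
          using fg(5) [OF that] M(2) \<open>0 \<notin> \<Omega>\<close> by auto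
      qed (use w in auto)
      also have "\<dots> < \<delta>"
        using z by (intro small) (auto simp: g0)
      finally have "g w \<in> \<Psi> ` V"
        using near fg(5) [OF wB] by auto
      then show "w \<in> (f \<circ> \<Psi>) ` V"
        using fg(5) [OF wB] by (metis image_comp image_eqI)
    qed
    have inj: "inj_on (f \<circ> \<Psi>) D"
      using \<Psi> fg(4) by (intro comp_inj_on) (auto intro!: inj_on_inverseI [of _ g])
    have hol: "f \<circ> \<Psi> holomorphic_on D"
      by (rule holomorphic_on_compose_gen [OF \<Psi>(1) fg(1) \<Psi>(3)])
    have img: "(f \<circ> \<Psi>) ` D \<subseteq> ball 0 1"
      using \<Psi> fg(4) by auto
    show ?thesis
      using span_metric_subset_le [OF \<open>open D\<close> \<open>open V\<close> \<open>V \<subseteq> D\<close> z(1) r(1) hol inj img _ sub] fg(3) by simp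
  qed
  then show ?thesis
    using \<open>0 < \<epsilon>\<close> by blast
qed

lemma span_metric_ratio_tendsto:
  assumes "open D" "open V" "V \<subseteq> D" "open \<Omega>" "simply_connected \<Omega>" "bounded \<Omega>" "0 \<notin> \<Omega>"
    and \<Psi>: "\<Psi> holomorphic_on D" "inj_on \<Psi> D" "\<Psi> ` D \<subseteq> \<Omega>"
    and near: "\<Omega> \<inter> ball 0 \<delta> \<subseteq> \<Psi> ` V" and "0 < \<delta>"
    and lim: "(\<Psi> \<longlongrightarrow> 0) (at p within V)"
  shows "((\<lambda>z. span_metric V z / span_metric D z) \<longlongrightarrow> 1) (at p within V)"
proof (rule tendstoI)
  fix e :: real assume "0 < e"
  \<comment> \<open>Chosen so that \<open>1 / r\<^sup>2 = 1 + e / 2\<close>, which keeps the ratio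
    strictly within \<open>e\<close> of 1.\<close>
  define r where "r = 1 / sqrt (1 + e / 2)"
  have r: "0 < r" "r < 1" "1 / r\<^sup>2 = 1 + e / 2"
    using \<open>0 < e\<close> by (simp_all add: r_def power_divide)
  obtain \<epsilon> where \<epsilon>: "0 < \<epsilon>" "\<And>z. z \<in> V \<Longrightarrow> cmod (\<Psi> z) < \<epsilon> \<Longrightarrow>
      0 < span_metric D z \<and> span_metric V z \<le> span_metric D z / r\<^sup>2"
    using span_metric_ratio_bound [OF assms(1-7) \<Psi> near \<open>0 < \<delta>\<close> r(1,2)] by blast
  have "\<forall>\<^sub>F z in at p within V. z \<in> V"
    by (simp add: eventually_at_filter)
  moreover have "\<forall>\<^sub>F z in at p within V. cmod (\<Psi> z) < \<epsilon>"
    using tendstoD [OF lim \<epsilon>(1)] by simp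
  ultimately show "\<forall>\<^sub>F z in at p within V. dist (span_metric V z / span_metric D z) 1 < e"
  proof eventually_elim
    case (elim z)
    have "0 < span_metric D z" "span_metric V z \<le> span_metric D z * (1 / r\<^sup>2)"
      using \<epsilon>(2) [OF elim] by simp_all
    then have "0 < span_metric D z" "span_metric V z \<le> span_metric D z * (1 + e / 2)"
      unfolding r(3) .
    moreover have "span_metric D z \<le> span_metric V z"
      using elim assms by (intro span_metric_antimono) auto
    ultimately have "1 \<le> span_metric V z / span_metric D z" "span_metric V z / span_metric D z \<le> 1 + e / 2"
      by (simp_all add: pos_le_divide_eq pos_divide_le_eq mult.commute)
    then show ?case
      using \<open>0 < e\<close> by (simp add: dist_real_def)
  qed
qed

section \<open>Topology of one side of a Jordan curve near a boundary point\<close>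

text \<open>A loop in \<open>V\<close> winds around no point off \<open>V\<close>. Outside
  \<open>B\<close> this follows from convexity; a point of \<open>B\<close> outside \<open>S\<close>
  is joined within the connected set \<open>- S\<close> to a point outside \<open>B\<close>; a point
  of another component is joined to the frontier of that component.\<close>

lemma simply_connected_component_Int_convex:
  fixes S :: "complex set"
  assumes "open S" and conS: "connected (- S)" and notB: "\<not> - S \<subseteq> B" and "open B" "convex B"
    and V: "V \<in> components (S \<inter> B)"
  shows "simply_connected V"
proof -
  have "open V" "connected V" and VSB: "V \<subseteq> S \<inter> B"
    using open_components [OF open_Int [OF \<open>open S\<close> \<open>open B\<close>] V] in_components_connected [OF V]
      in_components_subset [OF V] by auto
  have "winding_number \<gamma> z = 0"
    if \<gamma>: "path \<gamma>" "path_image \<gamma> \<subseteq> V" "pathfinish \<gamma> = pathstart \<gamma>" and z: "z \<notin> V" for \<gamma> z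
  proof -
    have outB: "winding_number \<gamma> w = 0" if "w \<notin> B" for w
      using winding_number_zero_outside [OF \<gamma>(1) \<open>convex B\<close> \<gamma>(3) that] \<gamma>(2) VSB by auto
    have out: "winding_number \<gamma> w = 0" if w: "w \<notin> S \<inter> B" for w
    proof (cases "w \<in> B")
      case True
      obtain q where q: "q \<in> - S" "q \<notin> B"
        using notB by blast
      have "winding_number \<gamma> w = winding_number \<gamma> q"
        using w True q VSB \<gamma>(2) by (intro winding_number_eq [OF \<gamma>(1,3) _ _ conS]) auto
      then show ?thesis
        using outB [OF q(2)] by simp
    qed (rule outB)
    show ?thesis
    proof (cases "z \<in> S \<inter> B")
      case True
      define W where "W = connected_component_set (S \<inter> B) z"
      have W: "W \<in> components (S \<inter> B)" "z \<in> W"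
        using True by (auto simp: W_def componentsI)
      have "V \<inter> W = {}"
        using components_nonoverlap [OF V W(1)] W(2) z by blast
      \<comment> \<open>An open set disjoint from \<open>W\<close> also misses its closure, so the
        winding number is constant on \<open>closure W\<close>, including at frontier points, which
        lie outside \<open>S \<inter> B\<close>.\<close>
      then have VW: "V \<inter> closure W = {}"
        using open_Int_closure_eq_empty [OF \<open>open V\<close>] by blast
      have "W \<noteq> UNIV"
        using \<open>V \<inter> W = {}\<close> V in_components_nonempty by blast
      then obtain w where w: "w \<in> frontier W"
        using W(2) frontier_eq_empty by blast
      then have "w \<in> frontier (S \<inter> B)"
        using frontier_of_components_subset [OF W(1)] by blast
      then have "w \<notin> S \<inter> B"
        using \<open>open S\<close> \<open>open B\<close> by (auto simp: frontier_def interior_open)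
      moreover have "winding_number \<gamma> z = winding_number \<gamma> w"
      proof (rule winding_number_eq [OF \<gamma>(1,3)])
        show "connected (closure W)"
          using W(1) by (intro connected_imp_connected_closure in_components_connected)
        show "z \<in> closure W" "w \<in> closure W"
          using W(2) w closure_subset by (auto simp: frontier_def)
        show "closure W \<inter> path_image \<gamma> = {}"
          using VW \<gamma>(2) by blast
      qed
      ultimately show ?thesis
        using out by simp
    qed (rule out)
  qed
  then show ?thesis
    using \<open>connected V\<close> simply_connected_eq_winding_number_zero [OF \<open>open V\<close>] by blast
qed

text \<open>Apply Janiszewski's theorem to the curve and to the union of the complement of the large disc
  with the closed subarc that avoids \<open>p\<close>: the intersection of these two sets is that subarc.\<close>

lemma Jordan_curve_uniformly_locally_connected:
  fixes g :: "real \<Rightarrow> complex"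
  assumes g: "simple_path g" "pathfinish g = pathstart g" and p: "p \<in> path_image g" and "0 < \<epsilon>"
  shows "\<exists>\<delta>>0. \<delta> \<le> \<epsilon> \<and> (\<forall>x y. x \<in> ball p \<delta> \<longrightarrow> y \<in> ball p \<delta> \<longrightarrow> connected_component (- path_image g) x y
      \<longrightarrow> connected_component (ball p \<epsilon> - path_image g) x y)"
proof -
  obtain a where a: "a \<in> {0..1}" "g a = p"
    using p by (auto simp: path_image_def)
  \<comment> \<open>Reparametrise the loop to start and end at \<open>p\<close>, so that the part
    near \<open>p\<close> includes both ends of the parameter interval.\<close>
  define h where "h = shiftpath a g"
  have h: "simple_path h" "path_image h = path_image g" "h 0 = p" "h 1 = p"
    using a g pathstart_shiftpath [of a g] pathfinish_shiftpath [of a g]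
      path_image_shiftpath [of a g] simple_path_shiftpath [of g a]
    by (auto simp: h_def pathstart_def pathfinish_def)
  have conth: "continuous_on {0..1} h"
    using h(1) by (simp add: simple_path_def path_def)
  obtain s where s: "0 < s" "\<And>x. x \<in> {0..1} \<Longrightarrow> dist x 0 < s \<Longrightarrow> dist (h x) p < \<epsilon>"
    using conth \<open>0 < \<epsilon>\<close> h(3) unfolding continuous_on_iff by (metis atLeastAtMost_iff order_refl zero_le_one)
  obtain s' where s': "0 < s'" "\<And>x. x \<in> {0..1} \<Longrightarrow> dist x 1 < s' \<Longrightarrow> dist (h x) p < \<epsilon>"
    using conth \<open>0 < \<epsilon>\<close> h(4) unfolding continuous_on_iff by (metis atLeastAtMost_iff order_refl zero_le_one)
  \<comment> \<open>Small enough that the two end pieces stay in \<open>ball p \<epsilon>\<close>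
    and that \<open>t..1 - t\<close> is a nonempty interval.\<close>
  define t where "t = min (min s s') 1 / 3"
  have t: "0 < t" "t < s" "t < s'" "t < 1 / 2"
    using s(1) s'(1) by (auto simp: t_def)
  define \<beta> where "\<beta> = h ` {t..1 - t}"
  have "continuous_on {t..1 - t} h"
    using conth by (rule continuous_on_subset) (use t in auto)
  then have "compact \<beta>" "connected \<beta>"
    unfolding \<beta>_def by (auto intro: compact_continuous_image connected_continuous_image)
  have "\<beta> \<subseteq> path_image g"
    unfolding h(2) [symmetric] unfolding \<beta>_def path_image_def using t by (intro image_mono) auto
  have "p \<notin> \<beta>"
  proof
    assume "p \<in> \<beta>"
    then obtain x where "x \<in> {t..1 - t}" "h x = h 0"
      using h(3) by (auto simp: \<beta>_def)
    then show False
      using h(1) t unfolding simple_path_def loop_free_def by fastforce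
  qed
  then obtain \<delta>' where \<delta>': "0 < \<delta>'" "ball p \<delta>' \<subseteq> - \<beta>"
    using \<open>compact \<beta>\<close> by (metis ComplI compact_imp_closed open_Compl open_contains_ball)
  have small: "path_image g - \<beta> \<subseteq> ball p \<epsilon>"
  proof
    fix w assume "w \<in> path_image g - \<beta>"
    then have "w \<in> h ` {0..1} - h ` {t..1 - t}"
      unfolding h(2) [symmetric] unfolding path_image_def \<beta>_def .
    then obtain x where x: "x \<in> {0..1}" "w = h x" "x \<notin> {t..1 - t}"
      by blast
    then have "dist x 0 < s \<or> dist x 1 < s'"
      using t by (auto simp: dist_real_def)
    then show "w \<in> ball p \<epsilon>"
      using s(2) s'(2) x by (auto simp: dist_commute)
  qed
  define T where "T = \<beta> \<union> - ball p \<epsilon>"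
  have "closed T"
    unfolding T_def by (intro closed_Un closed_Compl open_ball compact_imp_closed \<open>compact \<beta>\<close>)
  have "compact (path_image g)"
    using g(1) by (simp add: compact_simple_path_image)
  have "path_image g \<inter> T = \<beta>"
    using \<open>\<beta> \<subseteq> path_image g\<close> small by (auto simp: T_def)
  have "connected_component (ball p \<epsilon> - path_image g) x y"
    if "x \<in> ball p (min \<epsilon> \<delta>')" "y \<in> ball p (min \<epsilon> \<delta>')" "connected_component (- path_image g) x y" for x y
  proof -
    \<comment> \<open>The small ball is connected and misses \<open>T\<close>, so \<open>x\<close>
      and \<open>y\<close> are joined off \<open>T\<close>. Being joined off the curve as well, they
      are joined off the union, and avoiding \<open>T\<close> confines the connecting set to
      \<open>ball p \<epsilon>\<close>.\<close>
    have "ball p (min \<epsilon> \<delta>') \<subseteq> - T"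
      using \<delta>'(2) by (auto simp: T_def)
    then have "connected_component (- T) x y"
      using that connected_ball unfolding connected_component_def by blast
    with Janiszewski [OF \<open>compact (path_image g)\<close> \<open>closed T\<close>] that(3)
    have "connected_component (- (path_image g \<union> T)) x y"
      using \<open>path_image g \<inter> T = \<beta>\<close> \<open>connected \<beta>\<close> by simp
    moreover have "- (path_image g \<union> T) \<subseteq> ball p \<epsilon> - path_image g"
      by (auto simp: T_def)
    ultimately show ?thesis
      unfolding connected_component_def by (meson order_trans)
  qed
  then show ?thesis
    using \<open>0 < \<epsilon>\<close> \<delta>'(1) by (intro exI [of _ "min \<epsilon> \<delta>'"]) auto
qed

text \<open>\<open>V\<close> is the component of \<open>S \<inter> ball p \<epsilon>\<close>
  containing one point \<open>x0\<close> of \<open>S\<close> near \<open>p\<close>. Any other nearby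
  point of \<open>S\<close> is joined to \<open>x0\<close> off the curve inside \<open>S\<close>,
  hence by local connectedness also within \<open>ball p \<epsilon>\<close>.\<close>

lemma Jordan_side_neighbourhood:
  fixes g :: "real \<Rightarrow> complex"
  assumes g: "simple_path g" "pathfinish g = pathstart g" and p: "p \<in> path_image g" and "0 < \<epsilon>"
    and S: "open S" "connected S" "connected (- S)" "frontier S = path_image g"
    and notin: "\<not> - S \<subseteq> ball p \<epsilon>"
  obtains V \<delta> where "0 < \<delta>" "open V" "connected V" "simply_connected V" "V \<subseteq> S \<inter> ball p \<epsilon>" "S \<inter> ball p \<delta> \<subseteq> V"
proof -
  obtain \<delta> where \<delta>: "0 < \<delta>" "\<delta> \<le> \<epsilon>"
    "\<And>x y. x \<in> ball p \<delta> \<Longrightarrow> y \<in> ball p \<delta> \<Longrightarrow> connected_component (- path_image g) x y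
      \<Longrightarrow> connected_component (ball p \<epsilon> - path_image g) x y"
    using Jordan_curve_uniformly_locally_connected [OF g p \<open>0 < \<epsilon>\<close>] by blast
  have disj: "S \<inter> path_image g = {}"
    using S(1,4) by (metis Int_commute frontier_disjoint_eq)
  have "p \<in> closure S"
    using p S(4) by (auto simp: frontier_def)
  then obtain x0 where x0: "x0 \<in> S" "x0 \<in> ball p \<delta>"
    using \<delta>(1) by (metis closure_approachable dist_commute mem_ball)
  define V where "V = connected_component_set (S \<inter> ball p \<epsilon>) x0"
  have V: "V \<in> components (S \<inter> ball p \<epsilon>)"
    using x0 \<delta>(2) by (auto simp: V_def intro!: componentsI)
  show thesis
  proof (rule that [OF \<delta>(1)])
    show "open V" "connected V" "V \<subseteq> S \<inter> ball p \<epsilon>"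
      using open_components [OF open_Int [OF S(1) open_ball] V] in_components_connected [OF V]
        in_components_subset [OF V] by auto
    show "simply_connected V"
      by (rule simply_connected_component_Int_convex [OF S(1,3) notin _ _ V]) auto
    show "S \<inter> ball p \<delta> \<subseteq> V"
    proof
      fix y assume y: "y \<in> S \<inter> ball p \<delta>"
      have "connected_component (- path_image g) x0 y"
        using S(2) x0(1) y disj unfolding connected_component_def by blast
      then obtain T where T: "connected T" "T \<subseteq> ball p \<epsilon> - path_image g" "x0 \<in> T" "y \<in> T"
        using \<delta>(3) [OF x0(2)] y unfolding connected_component_def by blast
      \<comment> \<open>\<open>T\<close> is connected, meets \<open>S\<close> and misses its
        frontier.\<close>
      have "T \<subseteq> S"
        using connected_Int_frontier [OF T(1), of S] T(2,3) x0(1) S(4) by blast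
      then show "y \<in> V"
        using T unfolding V_def connected_component_def by blast
    qed
  qed
qed

section \<open>Normalising embeddings of the two sides of the curve\<close>

text \<open>The outside of a curve is not simply connected in the plane until the point at infinity
  is added. Inversion at \<open>a\<close> sends infinity to the finite point \<open>c\<close>, and
  \<open>\<Omega>\<close> is the image of \<open>S\<close> with \<open>c\<close> filled in; the
  shift by \<open>c\<close> sends \<open>p\<close> to 0.\<close>

lemma exterior_inversion:
  fixes S :: "complex set"
  defines "\<Psi> \<equiv> (\<lambda>a p z. 1 / (z - a) - 1 / (p - a))"
  assumes S: "open S" "connected S" "bounded (- S)" and a: "a \<in> interior (- S)"
    and con: "connected (- S - {a})" and p: "p \<notin> S" "p \<noteq> a" and "0 < \<delta>"
  obtains \<Omega> \<delta>' where "open \<Omega>" "simply_connected \<Omega>" "bounded \<Omega>" "0 \<notin> \<Omega>" "\<Psi> a p ` S \<subseteq> \<Omega>"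
    "0 < \<delta>'" "\<Omega> \<inter> ball 0 \<delta>' \<subseteq> \<Psi> a p ` (S \<inter> ball p \<delta>)"
proof -
  define c where "c = - 1 / (p - a)"
  define F where "F = \<Psi> a p"
  define G where "G w = a + 1 / (w - c)" for w
  have F: "F z = 1 / (z - a) + c" for z
    by (simp add: F_def \<Psi>_def c_def)
  have FG: "F (G w) = w" and G_ne: "G w \<noteq> a" if "w \<noteq> c" for w
    using that by (simp_all add: F G_def)
  have GF: "G (F z) = z" and F_ne: "F z \<noteq> c" if "z \<noteq> a" for z
    using that by (simp_all add: F G_def)
  have "c \<noteq> 0" "G 0 = p"
    using p by (auto simp: c_def G_def)
  have "a \<notin> S"
    using a interior_subset by blast
  then have GF_S: "G (F z) = z" if "z \<in> S" for z
    using that by (intro GF) auto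
  define \<Omega> where "\<Omega> = insert c (F ` S)"
  obtain R where R: "0 < R" "\<And>z. z \<notin> S \<Longrightarrow> cmod z \<le> R"
    using S(3) unfolding bounded_pos by auto
  \<comment> \<open>Nonzero distance less than \<open>\<rho>\<close> from \<open>c\<close> forces
    \<open>cmod (G w) > R\<close>, hence \<open>G w \<in> S\<close>: a punctured disc about
    \<open>c\<close> is covered.\<close>
  define \<rho> where "\<rho> = 1 / (R + cmod a + 1)"
  have "0 < \<rho>"
    using R(1) by (simp add: \<rho>_def add_pos_nonneg)
  have ball: "ball c \<rho> - {c} \<subseteq> F ` S"
  proof
    fix w assume w: "w \<in> ball c \<rho> - {c}"
    then have "cmod (w - c) < \<rho>" "0 < cmod (w - c)"
      by (auto simp: dist_norm norm_minus_commute)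
    then have "1 / \<rho> < 1 / cmod (w - c)"
      by (intro divide_strict_left_mono) (use \<open>0 < \<rho>\<close> in auto)
    then have "R + cmod a + 1 < cmod (1 / (w - c))"
      by (simp add: \<rho>_def norm_divide)
    also have "\<dots> \<le> cmod (G w) + cmod a"
      using norm_triangle_ineq4 [of "G w" a] by (simp add: G_def)
    finally have "G w \<in> S"
      using R(2) by force
    moreover have "w = F (G w)"
      using w FG by auto
    ultimately show "w \<in> F ` S"
      by (rule image_eqI [rotated])
  qed
  have holF: "F holomorphic_on S"
    unfolding F [abs_def] using \<open>a \<notin> S\<close> by (intro holomorphic_intros) auto
  have injF: "inj_on F S"
    using GF_S by (rule inj_on_inverseI)
  have \<Omega>_eq: "\<Omega> = F ` S \<union> ball c \<rho>"
    using ball \<open>0 < \<rho>\<close> by (auto simp: \<Omega>_def)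
  have "open \<Omega>"
    unfolding \<Omega>_eq using open_mapping_thm3 [OF holF S(1) injF] by auto
  have "c + of_real (\<rho> / 2) \<in> ball c \<rho> - {c}"
    using \<open>0 < \<rho>\<close> by (simp add: dist_norm)
  then have "F ` S \<inter> ball c \<rho> \<noteq> {}"
    using ball by blast
  then have "connected \<Omega>"
    unfolding \<Omega>_eq using holF S(2)
    by (intro connected_Un connected_continuous_image holomorphic_on_imp_continuous_on) auto
  obtain \<rho>' where \<rho>': "0 < \<rho>'" "ball a \<rho>' \<subseteq> - S"
    using a by (auto simp: mem_interior)
  have "bounded \<Omega>"
    unfolding bounded_iff
  proof (intro exI ballI)
    fix w assume "w \<in> \<Omega>"
    then consider "w = c" | z where "z \<in> S" "w = F z"
      by (auto simp: \<Omega>_def)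
    then show "cmod w \<le> 1 / \<rho>' + cmod c"
    proof cases
      case 2
      then have "z \<notin> ball a \<rho>'"
        using \<rho>'(2) by blast
      then have "\<rho>' \<le> cmod (z - a)"
        by (simp add: dist_norm norm_minus_commute)
      then have "cmod (1 / (z - a)) \<le> 1 / \<rho>'"
        using \<rho>'(1) by (simp add: norm_divide frac_le)
      then show ?thesis
        using norm_triangle_ineq [of "1 / (z - a)" c] 2 by (simp add: F)
    qed (use \<rho>' in auto)
  qed
  have compl: "- \<Omega> = F ` (- S - {a})"
  proof (intro set_eqI iffI)
    fix w assume w: "w \<in> - \<Omega>"
    then have "w \<noteq> c" "w \<notin> F ` S"
      by (simp_all add: \<Omega>_def)
    show "w \<in> F ` (- S - {a})"
    proof (rule image_eqI)
      show eq: "w = F (G w)"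
        using FG \<open>w \<noteq> c\<close> by simp
      have "G w \<notin> S"
        using \<open>w \<notin> F ` S\<close> image_eqI [of w F "G w" S, OF eq] by blast
      then show "G w \<in> - S - {a}"
        using G_ne [OF \<open>w \<noteq> c\<close>] by blast
    qed
  next
    fix w assume "w \<in> F ` (- S - {a})"
    then obtain z where z: "z \<notin> S" "z \<noteq> a" "w = F z"
      by blast
    have "w \<noteq> F x" if "x \<in> S" for x
      using that z(1,3) GF_S [OF that] GF [OF z(2)] by metis
    then show "w \<in> - \<Omega>"
      using F_ne [OF z(2)] z(3) by (auto simp: \<Omega>_def)
  qed
  \<comment> \<open>The complement is a continuous image of the connected set
    \<open>- S - {a}\<close>, and it is unbounded because \<open>\<Omega>\<close> is bounded. Its
    only component is thus unbounded, which is the criterion for simple connectedness.\<close>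
  have "connected (- \<Omega>)"
    unfolding compl F [abs_def] using con by (intro connected_continuous_image continuous_intros) auto
  moreover have "\<not> bounded (- \<Omega>)"
    using \<open>bounded \<Omega>\<close> bounded_Un [of \<Omega> "- \<Omega>"] by (simp add: Compl_partition)
  ultimately have "\<forall>C \<in> components (- \<Omega>). \<not> bounded C"
    by (metis bounded_empty components_eq_sing_iff singletonD)
  then have "simply_connected \<Omega>"
    using simply_connected_eq_unbounded_complement_components [OF \<open>open \<Omega>\<close>] \<open>connected \<Omega>\<close> by blast
  have "0 \<notin> \<Omega>"
  proof -
    have "F z \<noteq> 0" if "z \<in> S" for z
      using that GF_S [OF that] \<open>G 0 = p\<close> p(1) by metis
    then show ?thesis
      using \<open>c \<noteq> 0\<close> by (auto simp: \<Omega>_def)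
  qed
  have "isCont G 0"
    unfolding G_def [abs_def] using \<open>c \<noteq> 0\<close> by (intro continuous_intros) auto
  then obtain d where d: "0 < d" "\<And>w. dist w 0 < d \<Longrightarrow> dist (G w) p < \<delta>"
    using \<open>0 < \<delta>\<close> unfolding continuous_at_eps_delta \<open>G 0 = p\<close> by blast
  \<comment> \<open>The radius is also capped by \<open>cmod c\<close> to keep out the added point
    \<open>c\<close>, which comes from no point of \<open>S\<close>.\<close>
  have near: "\<Omega> \<inter> ball 0 (min d (cmod c)) \<subseteq> F ` (S \<inter> ball p \<delta>)"
  proof
    fix w assume w: "w \<in> \<Omega> \<inter> ball 0 (min d (cmod c))"
    then obtain z where z: "z \<in> S" "w = F z"
      by (auto simp: \<Omega>_def)
    have "G w = z"
      unfolding z(2) using z(1) by (rule GF_S)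
    then have "z \<in> S \<inter> ball p \<delta>"
      using d(2) [of w] w z(1) by (simp add: dist_commute)
    with z(2) show "w \<in> F ` (S \<inter> ball p \<delta>)"
      by (rule image_eqI)
  qed
  show thesis
  proof (rule that [OF \<open>open \<Omega>\<close> \<open>simply_connected \<Omega>\<close> \<open>bounded \<Omega>\<close> \<open>0 \<notin> \<Omega>\<close>])
    show "\<Psi> a p ` S \<subseteq> \<Omega>"
      unfolding \<Omega>_def F_def by (rule subset_insertI)
    show "0 < min d (cmod c)"
      using d(1) \<open>c \<noteq> 0\<close> by simp
    show "\<Omega> \<inter> ball 0 (min d (cmod c)) \<subseteq> \<Psi> a p ` (S \<inter> ball p \<delta>)"
      using near unfolding F_def .
  qed
qed

text \<open>Here \<open>S\<close>, translated so that \<open>p\<close> goes to 0, can itself serve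
  as \<open>\<Omega>\<close>.\<close>

lemma span_metric_ratio_interior:
  assumes "open D" "open V" "V \<subseteq> D" "D \<subseteq> S" "open S" "simply_connected S" "bounded S" "p \<notin> S"
    and "0 < \<delta>" "S \<inter> ball p \<delta> \<subseteq> V"
  shows "((\<lambda>z. span_metric V z / span_metric D z) \<longlongrightarrow> 1) (at p within V)"
proof (rule span_metric_ratio_tendsto [of D V "(\<lambda>z. - p + z) ` S" "\<lambda>z. - p + z" \<delta>])
  show "open ((\<lambda>z. - p + z) ` S)" "bounded ((\<lambda>z. - p + z) ` S)"
    using open_translation [OF \<open>open S\<close>] bounded_translation [OF \<open>bounded S\<close>] .
  show "simply_connected ((\<lambda>z. - p + z) ` S)"
    using homeomorphic_translation \<open>simply_connected S\<close> by (rule homeomorphic_simply_connected)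
  show "(\<lambda>z. - p + z) ` S \<inter> ball 0 \<delta> \<subseteq> (\<lambda>z. - p + z) ` V"
    using assms(10) by (force simp: dist_norm norm_minus_commute)
  have "((\<lambda>z. - p + z) \<longlongrightarrow> - p + p) (at p within V)"
    by (intro tendsto_intros)
  then show "((\<lambda>z. - p + z) \<longlongrightarrow> 0) (at p within V)"
    by simp
qed (use assms in \<open>auto intro!: holomorphic_intros simp: inj_on_def\<close>)

lemma span_metric_ratio_exterior:
  assumes "open D" "open V" "V \<subseteq> D" "D \<subseteq> S" "open S" "connected S" "bounded (- S)"
    and a: "a \<in> interior (- S)" and con: "connected (- S - {a})" and p: "p \<notin> S" "p \<noteq> a"
    and "0 < \<delta>" "S \<inter> ball p \<delta> \<subseteq> V"
  shows "((\<lambda>z. span_metric V z / span_metric D z) \<longlongrightarrow> 1) (at p within V)"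
proof -
  obtain \<Omega> \<delta>' where \<Omega>: "open \<Omega>" "simply_connected \<Omega>" "bounded \<Omega>" "0 \<notin> \<Omega>"
    "(\<lambda>z. 1 / (z - a) - 1 / (p - a)) ` S \<subseteq> \<Omega>" "0 < \<delta>'"
    "\<Omega> \<inter> ball 0 \<delta>' \<subseteq> (\<lambda>z. 1 / (z - a) - 1 / (p - a)) ` (S \<inter> ball p \<delta>)"
    using exterior_inversion [OF assms(5-7) a con p \<open>0 < \<delta>\<close>] .
  have "a \<notin> S"
    using a interior_subset by blast
  show ?thesis
  proof (rule span_metric_ratio_tendsto [OF assms(1-3) \<Omega>(1-4) _ _ _ _ \<Omega>(6)])
    show "(\<lambda>z. 1 / (z - a) - 1 / (p - a)) holomorphic_on D"
      using \<open>a \<notin> S\<close> \<open>D \<subseteq> S\<close> by (intro holomorphic_intros) auto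
    show "inj_on (\<lambda>z. 1 / (z - a) - 1 / (p - a)) D"
      by (auto simp: inj_on_def)
    show "(\<lambda>z. 1 / (z - a) - 1 / (p - a)) ` D \<subseteq> \<Omega>"
      using \<Omega>(5) \<open>D \<subseteq> S\<close> by blast
    show "\<Omega> \<inter> ball 0 \<delta>' \<subseteq> (\<lambda>z. 1 / (z - a) - 1 / (p - a)) ` V"
      using \<Omega>(7) assms(13) by blast
    have "((\<lambda>z. 1 / (z - a) - 1 / (p - a)) \<longlongrightarrow> 1 / (p - a) - 1 / (p - a)) (at p within V)"
      using p(2) by (intro tendsto_intros) auto
    then show "((\<lambda>z. 1 / (z - a) - 1 / (p - a)) \<longlongrightarrow> 0) (at p within V)"
      by simp
  qed
qed

text \<open>Deleting a point from a connected open planar set keeps it connected, and the set in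
  question lies between \<open>S - {a}\<close> and its closure. It is applied to the inside of the
  curve, whose closure is the complement of the outside.\<close>

lemma connected_closure_delete:
  fixes S :: "complex set"
  assumes "open S" "connected S"
  shows "connected (closure S - {a})"
proof (rule connected_intermediate_closure)
  show "connected (S - {a})"
    using assms by (intro connected_open_delete) auto
  show "S - {a} \<subseteq> closure S - {a}"
    using closure_subset by blast
  show "closure S - {a} \<subseteq> closure (S - {a})"
    using open_Int_closure_subset [of "- {a}" S] by (auto simp: Diff_eq Int_commute)
qed

section \<open>Choice of the neighbourhood and conclusion\<close>

theorem proposition3p2:
  fixes l :: nat and D :: "complex set" and p :: complex
  assumes "l \<ge> 1" and "jordan_domain l D" and "p \<in> frontier D"
  shows "\<exists>U. open U \<and> p \<in> U \<and> simply_connected (U \<inter> D) \<and>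
    ((\<lambda>z. span_metric (U \<inter> D) z / span_metric D z) \<longlongrightarrow> 1) (at p within (U \<inter> D))"
proof -
  obtain C :: "nat \<Rightarrow> complex set" where D: "open D" "connected D" and C: "\<And>i. i < l \<Longrightarrow> jordan_curve (C i)"
    "disjoint_family_on C {..<l}" "frontier D = (\<Union>i<l. C i)"
    using assms(2) unfolding jordan_domain_def by blast
  then obtain j where j: "j < l" "p \<in> C j"
    using assms(3) by blast
  then obtain g where g: "simple_path g" "pathfinish g = pathstart g" "path_image g = C j"
    using C(1) unfolding jordan_curve_def by blast
  note J = Jordan_inside_outside [OF g(1,2)]
  define I where "I = inside (C j)"
  define E where "E = outside (C j)"
  have I: "open I" "connected I" "I \<noteq> {}" "bounded I" "frontier I = C j"
    and E: "open E" "connected E" "frontier E = C j" and IE: "I \<inter> E = {}" "I \<union> E = - C j"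
    using J unfolding I_def E_def g(3) by auto
  have clI: "closure I = - E" and clE: "closure E = - I"
    unfolding closure_Un_frontier I(5) E(3) using IE by blast+
  have conI: "connected (- I)" and conE: "connected (- E)"
    using connected_imp_connected_closure [OF E(2)] connected_imp_connected_closure [OF I(2)] unfolding clI clE .
  have "bounded (- E)"
    using bounded_closure [OF I(4)] unfolding clI .

  \<comment> \<open>The other boundary curves: a closed set not containing \<open>p\<close>, so a
    small ball about \<open>p\<close> meets only the curve \<open>C j\<close>.\<close>
  define K where "K = (\<Union>i\<in>{..<l} - {j}. C i)"
  have frontier_D: "frontier D = C j \<union> K"
    using C(3) j(1) by (auto simp: K_def)
  have "closed (C i)" if "i < l" for i
    using C(1) [OF that] unfolding jordan_curve_def by (metis closed_simple_path_image)
  then have "closed K"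
    unfolding K_def by (intro closed_UN) auto
  have "p \<notin> K"
    using C(2) j unfolding K_def disjoint_family_on_def by blast
  then obtain \<epsilon>0 where \<epsilon>0: "0 < \<epsilon>0" "ball p \<epsilon>0 \<subseteq> - K"
    using \<open>closed K\<close> by (metis ComplI open_Compl open_contains_ball)
  \<comment> \<open>At least one of two distinct points of the curve differs from \<open>p\<close>.
    Keeping \<open>q\<close> out of \<open>ball p \<epsilon>\<close> ensures that the complement of
    either side is not contained in that ball.\<close>
  have "g 0 \<noteq> g (1 / 2)"
    using g(1) unfolding simple_path_def loop_free_def by fastforce
  moreover have "g 0 \<in> C j" "g (1 / 2) \<in> C j"
    unfolding g(3) [symmetric] path_image_def by auto
  ultimately obtain q where q: "q \<in> C j" "q \<noteq> p"
    by metis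
  define \<epsilon> where "\<epsilon> = min \<epsilon>0 (dist p q)"
  have \<epsilon>: "0 < \<epsilon>" "ball p \<epsilon> \<inter> K = {}" "q \<notin> ball p \<epsilon>"
    using \<epsilon>0 q by (auto simp: \<epsilon>_def)

  have "D \<inter> frontier D = {}"
    using D(1) by (metis Int_commute frontier_disjoint_eq)
  have "D \<noteq> {}"
    using assms(3) by auto
  have "D \<subseteq> I \<union> E"
    using \<open>D \<inter> frontier D = {}\<close> frontier_D IE by blast
  then have "D \<subseteq> I \<or> D \<subseteq> E"
    using connectedD [OF D(2) I(1) E(1)] IE(1) by blast
  have local: "\<exists>V \<delta>. 0 < \<delta> \<and> open V \<and> simply_connected V \<and> V \<subseteq> D \<and> S \<inter> ball p \<delta> \<subseteq> V"
    if S: "S = I \<or> S = E" "D \<subseteq> S" for S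
  proof -
    have S': "open S" "connected S" "connected (- S)" "frontier S = path_image g" "q \<in> - S"
      using S(1) I(1,2,5) E conI conE q(1) IE(2) unfolding g(3) by blast+
    have "\<not> - S \<subseteq> ball p \<epsilon>"
      using S'(5) \<epsilon>(3) by blast
    have "p \<in> path_image g"
      using j(2) g(3) by simp
    obtain V \<delta> where V: "0 < \<delta>" "open V" "connected V" "simply_connected V"
        "V \<subseteq> S \<inter> ball p \<epsilon>" "S \<inter> ball p \<delta> \<subseteq> V"
      using Jordan_side_neighbourhood [OF g(1,2) \<open>p \<in> path_image g\<close> \<epsilon>(1) S'(1-4) \<open>\<not> - S \<subseteq> ball p \<epsilon>\<close>] .
    have "p \<in> closure D"
      using assms(3) by (simp add: frontier_def)
    then obtain x where "x \<in> D" "x \<in> ball p \<delta>"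
      using V(1) unfolding closure_approachable mem_ball by (metis dist_commute)
    then have "V \<inter> D \<noteq> {}"
      using V(6) S(2) by blast
    \<comment> \<open>\<open>V\<close> lies in \<open>S\<close>, which misses \<open>C j\<close>,
      and in \<open>ball p \<epsilon>\<close>, which misses \<open>K\<close>. Being connected and
      meeting \<open>D\<close>, it then lies in \<open>D\<close>.\<close>
    moreover have "V \<inter> frontier D = {}"
      using V(5) \<epsilon>(2) S(1) IE(2) unfolding frontier_D by blast
    ultimately have "V \<subseteq> D"
      using connected_Int_frontier [OF V(3), of D] by blast
    with V show ?thesis
      by blast
  qed
  have result: ?thesis
    if "open V" "simply_connected V" "V \<subseteq> D" "D \<subseteq> S" "0 < \<delta>" "S \<inter> ball p \<delta> \<subseteq> V"
      "((\<lambda>z. span_metric V z / span_metric D z) \<longlongrightarrow> 1) (at p within V)" for V S \<delta>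
  proof -
    \<comment> \<open>Adding the ball puts \<open>p\<close> in the neighbourhood without changing
      its intersection with \<open>D\<close>.\<close>
    have eq: "(V \<union> ball p \<delta>) \<inter> D = V"
      using that(3,4,6) by blast
    show ?thesis
      using that(1,2,5,7) by (intro exI [of _ "V \<union> ball p \<delta>"] conjI) (simp_all only: eq open_Un open_ball Un_iff centre_in_ball simp_thms)
  qed
  from \<open>D \<subseteq> I \<or> D \<subseteq> E\<close> show ?thesis
  proof
    assume "D \<subseteq> I"
    then obtain V \<delta> where V: "0 < \<delta>" "open V" "simply_connected V" "V \<subseteq> D" "I \<inter> ball p \<delta> \<subseteq> V"
      using local [of I] by blast
    have "p \<notin> I"
      using IE(2) j(2) by blast
    have "simply_connected I"
      using simply_connected_inside_simple_path [OF g(1)] by (simp add: I_def g(3))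
    show ?thesis
      by (rule result [OF V(2,3,4) \<open>D \<subseteq> I\<close> V(1,5)])
         (rule span_metric_ratio_interior [OF D(1) V(2,4) \<open>D \<subseteq> I\<close> I(1) \<open>simply_connected I\<close> I(4) \<open>p \<notin> I\<close> V(1,5)])
  next
    assume "D \<subseteq> E"
    then obtain V \<delta> where V: "0 < \<delta>" "open V" "simply_connected V" "V \<subseteq> D" "E \<inter> ball p \<delta> \<subseteq> V"
      using local [of E] by blast
    obtain a where "a \<in> I"
      using I(3) by blast
    then have a: "a \<in> interior (- E)"
      using I(1) IE(1) by (intro interiorI [of I]) auto
    have p: "p \<notin> E" "p \<noteq> a"
      using IE(2) j(2) \<open>a \<in> I\<close> by blast+
    have con: "connected (- E - {a})"
      using connected_closure_delete [OF I(1,2)] by (simp add: clI)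
    show ?thesis
      by (rule result [OF V(2,3,4) \<open>D \<subseteq> E\<close> V(1,5)])
         (rule span_metric_ratio_exterior [OF D(1) V(2,4) \<open>D \<subseteq> E\<close> E(1,2) \<open>bounded (- E)\<close> a con p V(1,5)])
  qed
qed

end
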